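(* Let $A\in\mathbb{R}^{n\times n}$, $B\in\mathbb{R}^{n\times m}$ with $(A,B)$ stabilizable, let $Q\in\mathbb{R}^{n\times n}$ be symmetric positive semidefinite and $R\in\mathbb{R}^{m\times m}$ symmetric positive definite. Let $\bar K\in\mathbb{R}^{m\times n}$ be the optimal LQR gain, i.e. the gain for which $u_k=\bar Kx_k$ minimizes $$J=\sum_{k=0}^{\infty}\left(x_k^\top Qx_k+u_k^\top Ru_k\right)$$ subject to $x_{k+1}=Ax_k+Bu_k$, with $A+B\bar K$ stable, and let $\bar P\succ 0$ be the corresponding LQR value matrix, satisfying $$\bar P=Q+\bar K^\top R\bar K+(A+B\bar K)^\top\bar P(A+B\bar K).$$ Then the LQR closed-loop system $x_{k+1}=(A+B\bar K)x_k$ is equivalent to the trajectory-oriented gradient descent system $x_{k+1}=(I-2\bar\Gamma\bar P)x_k$ with $$\bar\Gamma=\tfrac12\left(I-(A+B\bar K)\right)\bar P^{-1};$$ that is, $A+B\bar K=I-2\bar\Gamma\bar P$ and $\bar\Gamma\succ0$.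
   Context: A trajectory-oriented gradient descent system is one of the form $x_{k+1}=x_k-\Gamma\,\partial V_k/\partial x_k=(I-2\Gamma P)x_k$, where $V_k=x_k^\top Px_k$, $P$ is symmetric positive definite, and the step size matrix $\Gamma\in\mathbb{R}^{n\times n}$ satisfies $\Gamma\succ0$. The matrix $\Gamma$ is allowed to be non-symmetric, and $\Gamma\succ 0$ means $z^\top\Gamma z>0$ for all nonzero $z\in\mathbb{R}^n$. $\bar P\succ 0$ means symmetric positive definite. A matrix is stable if all its eigenvalues have modulus less than $1$; $(A,B)$ is stabilizable if $A+BK$ is stable for some $K$. *)

theory Defs
  imports "HOL-Analysis.Analysis"
begin

text \<open>Definiteness of a possibly non-symmetric real matrix: no symmetry is required in
  \<open>posdef_form\<close>, in contrast to \<open>sym_posdef\<close>.\<close>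

definition posdef_form :: "real^'n^'n \<Rightarrow> bool" where
  "posdef_form M \<longleftrightarrow> (\<forall>z. z \<noteq> 0 \<longrightarrow> z \<bullet> (M *v z) > 0)"

definition sym_posdef :: "real^'n^'n \<Rightarrow> bool" where
  "sym_posdef M \<longleftrightarrow> transpose M = M \<and> posdef_form M"

definition sym_possemidef :: "real^'n^'n \<Rightarrow> bool" where
  "sym_possemidef M \<longleftrightarrow> transpose M = M \<and> (\<forall>z. z \<bullet> (M *v z) \<ge> 0)"

text \<open>The eigenvalues of a real matrix are taken over the complex numbers.\<close>

definition complex_eigenvalue :: "real^'n^'n \<Rightarrow> complex \<Rightarrow> bool" where
  "complex_eigenvalue M c \<longleftrightarrow>
     (\<exists>v::complex^'n. v \<noteq> 0 \<and> (\<chi> i j. complex_of_real (M $ i $ j)) *v v = c *s v)"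

definition stable_matrix :: "real^'n^'n \<Rightarrow> bool" where
  "stable_matrix M \<longleftrightarrow> (\<forall>c. complex_eigenvalue M c \<longrightarrow> cmod c < 1)"

definition stabilizable :: "real^'n^'n \<Rightarrow> real^'m^'n \<Rightarrow> bool" where
  "stabilizable A B \<longleftrightarrow> (\<exists>K::real^'n^'m. stable_matrix (A + B ** K))"

definition lqr_trajectory ::
    "real^'n^'n \<Rightarrow> real^'m^'n \<Rightarrow> (nat \<Rightarrow> real^'n) \<Rightarrow> (nat \<Rightarrow> real^'m) \<Rightarrow> bool" where
  "lqr_trajectory A B x u \<longleftrightarrow> (\<forall>k. x (Suc k) = A *v x k + B *v u k)"

text \<open>The cost is extended-valued, since it may diverge. For positive semidefinite \<open>Q\<close>, \<open>R\<close>
  the stage costs are nonnegative, so \<open>ennreal\<close> does not truncate them.\<close>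

definition lqr_cost ::
    "real^'n^'n \<Rightarrow> real^'m^'m \<Rightarrow> (nat \<Rightarrow> real^'n) \<Rightarrow> (nat \<Rightarrow> real^'m) \<Rightarrow> ennreal" where
  "lqr_cost Q R x u = (\<Sum>k. ennreal (x k \<bullet> (Q *v x k) + u k \<bullet> (R *v u k)))"

text \<open>For every initial state, the feedback \<open>u k = K *v x k\<close> is optimal among all input
  sequences, not only among linear or stabilizing feedbacks.\<close>

definition lqr_optimal_gain ::
    "real^'n^'n \<Rightarrow> real^'m^'n \<Rightarrow> real^'n^'n \<Rightarrow> real^'m^'m \<Rightarrow> real^'n^'m \<Rightarrow> bool" where
  "lqr_optimal_gain A B Q R K \<longleftrightarrow>
     (\<forall>x y v. lqr_trajectory A B x (\<lambda>k. K *v x k) \<and> lqr_trajectory A B y v \<and> y 0 = x 0 \<longrightarrow>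
        lqr_cost Q R x (\<lambda>k. K *v x k) \<le> lqr_cost Q R y v)"

definition lqr_value_matrix ::
    "real^'n^'n \<Rightarrow> real^'m^'n \<Rightarrow> real^'n^'n \<Rightarrow> real^'m^'m \<Rightarrow> real^'n^'n \<Rightarrow> bool" where
  "lqr_value_matrix A B Q R P \<longleftrightarrow>
     (\<forall>x0. Inf {lqr_cost Q R x u | x u. lqr_trajectory A B x u \<and> x 0 = x0}
           = ennreal (x0 \<bullet> (P *v x0)))"

definition closed_loop_trajectory ::
    "real^'n^'n \<Rightarrow> real^'m^'n \<Rightarrow> real^'n^'m \<Rightarrow> (nat \<Rightarrow> real^'n) \<Rightarrow> bool" where
  "closed_loop_trajectory A B K x \<longleftrightarrow> (\<forall>k. x (Suc k) = (A + B ** K) *v x k)"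

text \<open>\<open>x (k+1) = x k - \<Gamma> (\<partial>V/\<partial>x) (x k)\<close> for \<open>V x = x\<^sup>T P x\<close>; here \<open>g\<close> is the gradient of \<open>V\<close>
  at \<open>x k\<close>.\<close>

definition gradient_descent_trajectory ::
    "real^'n^'n \<Rightarrow> real^'n^'n \<Rightarrow> (nat \<Rightarrow> real^'n) \<Rightarrow> bool" where
  "gradient_descent_trajectory \<Gamma> P x \<longleftrightarrow>
     (\<forall>k. \<exists>g. GDERIV (\<lambda>z. z \<bullet> (P *v z)) (x k) :> g \<and> x (Suc k) = x k - \<Gamma> *v g)"

end

theory Submission
  imports Defs
begin

text \<open>Write \<open>F = A + B K\<close>, \<open>w = P\<^sup>-\<^sup>1 z\<close> and \<open>d = w - F w\<close>, so that \<open>2 z\<^sup>T \<Gamma> z = w\<^sup>T P d\<close>. The value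
  equation gives \<open>(F w)\<^sup>T P (F w) \<le> w\<^sup>T P w\<close>, hence
  \<open>d\<^sup>T P d = w\<^sup>T P w - 2 w\<^sup>T P F w + (F w)\<^sup>T P (F w) \<le> 2 w\<^sup>T P d\<close>. The left-hand side is positive
  because \<open>d = 0\<close> would make \<open>1\<close> an eigenvalue of the stable matrix \<open>F\<close>.\<close>

text \<open>Eigenvectors live in \<open>complex^'n\<close>, so a nonzero real fixed vector is
  embedded entrywise; it then has eigenvalue 1, whose modulus is not below 1.\<close>

lemma stable_matrix_no_fixed_vector:
  fixes F :: "real^'n^'n"
  assumes "stable_matrix F" and "F *v w = w"
  shows "w = 0"
proof (rule ccontr)
  assume "w \<noteq> 0"
  let ?v = "(\<chi> i. complex_of_real (w $ i)) :: complex^'n"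
  have "?v \<noteq> 0"
    using \<open>w \<noteq> 0\<close> by (simp add: vec_eq_iff)
  moreover have "(\<chi> i j. complex_of_real (F $ i $ j)) *v ?v = 1 *s ?v"
  proof -
    have "(\<Sum>j\<in>UNIV. complex_of_real (F $ i $ j) * complex_of_real (w $ j)) = of_real (w $ i)" for i
      by (subst assms(2)[symmetric]) (simp add: matrix_vector_mult_def)
    then show ?thesis
      by (simp add: vec_eq_iff matrix_vector_mult_def)
  qed
  ultimately have "complex_eigenvalue F 1"
    unfolding complex_eigenvalue_def by blast
  with assms(1) show False
    by (force simp: stable_matrix_def)
qed

lemma inner_matrix_symmetric:
  fixes P :: "real^'n^'n"
  assumes "transpose P = P"
  shows "x \<bullet> (P *v y) = y \<bullet> (P *v x)"
  by (metis assms dot_lmul_matrix inner_commute transpose_matrix_vector)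

text \<open>A kernel vector has zero quadratic form, so the kernel is trivial, which suffices for a
  square matrix.\<close>

lemma posdef_form_invertible:
  fixes P :: "real^'n^'n"
  assumes "posdef_form P"
  shows "invertible P"
proof -
  have "P *v x = 0 \<Longrightarrow> x = 0" for x
    using assms by (force simp: posdef_form_def)
  then show ?thesis
    by (metis invertible_left_inverse matrix_left_invertible_ker)
qed

text \<open>The product rule yields two terms that symmetry makes equal; this is the source of the
  factor 2 in \<open>mat 1 - 2 *\<^sub>R (\<Gamma> ** P)\<close>.\<close>

lemma GDERIV_quadratic_form:
  fixes P :: "real^'n^'n"
  assumes "transpose P = P"
  shows "GDERIV (\<lambda>z. z \<bullet> (P *v z)) x :> 2 *\<^sub>R (P *v x)"
proof -
  have "((\<lambda>z. z \<bullet> (P *v z)) has_derivative (\<lambda>h. x \<bullet> (P *v h) + h \<bullet> (P *v x))) (at x)"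
    by (intro has_derivative_inner has_derivative_ident
        bounded_linear.has_derivative[OF matrix_vector_mul_bounded_linear])
  moreover have "(\<lambda>h. x \<bullet> (P *v h) + h \<bullet> (P *v x)) = (\<lambda>h. h \<bullet> (2 *\<^sub>R (P *v x)))"
    using inner_matrix_symmetric[OF assms, of x] by auto
  ultimately show ?thesis
    by (simp add: gderiv_def)
qed

lemma GDERIV_unique:
  assumes "GDERIV f x :> g" and "GDERIV f x :> g'"
  shows "g = g'"
proof -
  have "(\<lambda>h. h \<bullet> g) = (\<lambda>h. h \<bullet> g')"
    using assms unfolding gderiv_def by (rule has_derivative_unique)
  then show ?thesis
    by (metis vector_eq_ldot)
qed

text \<open>Existence and uniqueness of the gradient turn the existential over \<open>g\<close> into
  an explicit linear recursion.\<close>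

lemma gradient_descent_trajectory_iff:
  fixes P :: "real^'n^'n"
  assumes "transpose P = P"
  shows "gradient_descent_trajectory \<Gamma> P x \<longleftrightarrow>
    (\<forall>k. x (Suc k) = (mat 1 - 2 *\<^sub>R (\<Gamma> ** P)) *v x k)"
proof -
  have "(\<exists>g. GDERIV (\<lambda>z. z \<bullet> (P *v z)) (x k) :> g \<and> x (Suc k) = x k - \<Gamma> *v g) \<longleftrightarrow>
      x (Suc k) = x k - \<Gamma> *v (2 *\<^sub>R (P *v x k))" for k
    using GDERIV_quadratic_form[OF assms] GDERIV_unique by blast
  then show ?thesis
    by (simp add: gradient_descent_trajectory_def matrix_vector_mult_diff_rdistrib
        matrix_vector_mul_assoc matrix_vector_mult_scaleR scaleR_matrix_vector_assoc
        matrix_scalar_ac scalar_matrix_assoc)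
qed

text \<open>The decrease \<open>le\<close> is not strict, since \<open>Q\<close> may be singular;
  strictness comes from stability, which forces \<open>?d\<close> to be nonzero.\<close>

lemma lyapunov_inner_pos:
  fixes F P :: "real^'n^'n"
  assumes "sym_posdef P" and "stable_matrix F"
    and le: "(F *v w) \<bullet> (P *v (F *v w)) \<le> w \<bullet> (P *v w)"
    and "w \<noteq> 0"
  shows "w \<bullet> (P *v (w - F *v w)) > 0"
proof -
  let ?d = "w - F *v w"
  have "?d \<noteq> 0"
    using stable_matrix_no_fixed_vector[OF assms(2), of w] \<open>w \<noteq> 0\<close> by auto
  then have "0 < ?d \<bullet> (P *v ?d)"
    using assms(1) by (simp add: sym_posdef_def posdef_form_def)
  also have "\<dots> = w \<bullet> (P *v w) - 2 * (w \<bullet> (P *v (F *v w))) + (F *v w) \<bullet> (P *v (F *v w))"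
    using inner_matrix_symmetric[of P "F *v w" w] assms(1)
    by (simp add: sym_posdef_def matrix_vector_mult_diff_distrib inner_diff_left inner_diff_right)
  also have "\<dots> \<le> 2 * (w \<bullet> (P *v ?d))"
    using le by (simp add: matrix_vector_mult_diff_distrib inner_diff_right)
  finally show ?thesis by simp
qed

lemma inner_congruence:
  fixes M :: "real^'m^'m" and N :: "real^'n^'m"
  shows "w \<bullet> ((transpose N ** M ** N) *v w) = (N *v w) \<bullet> (M *v (N *v w))"
  by (metis dot_lmul_matrix inner_commute matrix_vector_mul_assoc transpose_matrix_vector)

theorem lemma2:
  fixes A :: "real^'n^'n" and B :: "real^'m^'n"
    and Q :: "real^'n^'n" and R :: "real^'m^'m"
    and K :: "real^'n^'m" and P :: "real^'n^'n" and \<Gamma> :: "real^'n^'n"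
  assumes "stabilizable A B"
    and "sym_possemidef Q"
    and "sym_posdef R"
    and "lqr_optimal_gain A B Q R K"
    and "stable_matrix (A + B ** K)"
    and "sym_posdef P"
    and "lqr_value_matrix A B Q R P"
    and "P = Q + transpose K ** R ** K + transpose (A + B ** K) ** P ** (A + B ** K)"
    and "\<Gamma> = (1/2) *\<^sub>R ((mat 1 - (A + B ** K)) ** matrix_inv P)"
  shows "(\<forall>x. closed_loop_trajectory A B K x \<longleftrightarrow> gradient_descent_trajectory \<Gamma> P x) \<and>
         A + B ** K = mat 1 - 2 *\<^sub>R (\<Gamma> ** P) \<and>
         posdef_form \<Gamma>"
proof -
  let ?F = "A + B ** K"
  have P: "transpose P = P" "posdef_form P"
    using assms(6) by (auto simp: sym_posdef_def)
  \<comment> \<open>\<open>matrix_inv\<close> is a Hilbert choice, so its two-sided inverse property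
    follows once some inverse exists.\<close>
  have "P ** matrix_inv P = mat 1 \<and> matrix_inv P ** P = mat 1"
    using posdef_form_invertible[OF P(2)] unfolding invertible_def matrix_inv_def by (rule someI_ex)
  then have inv: "matrix_inv P ** P = mat 1" "P ** matrix_inv P = mat 1"
    by auto
  have eq: "?F = mat 1 - 2 *\<^sub>R (\<Gamma> ** P)"
    by (simp add: assms(9) scalar_matrix_assoc[symmetric] matrix_mul_assoc[symmetric] inv)
  have "posdef_form \<Gamma>"
    unfolding posdef_form_def
  proof (intro allI impI)
    fix z :: "real^'n" assume "z \<noteq> 0"
    \<comment> \<open>In the variable \<open>w\<close> the inverse disappears:
      \<open>\<Gamma> *v z\<close> becomes half of \<open>w - ?F *v w\<close>.\<close>
    define w where "w = matrix_inv P *v z"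
    have z: "z = P *v w"
      by (simp add: w_def matrix_vector_mul_assoc inv)
    with \<open>z \<noteq> 0\<close> have "w \<noteq> 0" by auto
    have "w \<bullet> (P *v w) = w \<bullet> (Q *v w) + (K *v w) \<bullet> (R *v (K *v w))
        + (?F *v w) \<bullet> (P *v (?F *v w))"
      \<comment> \<open>\<open>P\<close> occurs on both sides of the value equation, so it is
        unfolded only once; \<open>inner_congruence\<close> then treats the \<open>R\<close> and
        \<open>P\<close> terms alike.\<close>
      by (subst assms(8)) (simp only: matrix_vector_mult_add_rdistrib inner_add_right inner_congruence)
    moreover have "w \<bullet> (Q *v w) \<ge> 0"
      using assms(2) by (simp add: sym_possemidef_def)
    moreover have "(K *v w) \<bullet> (R *v (K *v w)) \<ge> 0"
      using assms(3) by (cases "K *v w = 0") (auto simp: sym_posdef_def posdef_form_def intro: less_imp_le)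
    ultimately have "w \<bullet> (P *v (w - ?F *v w)) > 0"
      using \<open>w \<noteq> 0\<close> by (intro lyapunov_inner_pos assms(5,6)) auto
    moreover have "\<Gamma> *v z = (1/2) *\<^sub>R (w - ?F *v w)"
      by (simp only: assms(9) scaleR_matrix_vector_assoc[symmetric] matrix_vector_mul_assoc[symmetric]
          w_def[symmetric] matrix_vector_mult_diff_rdistrib matrix_vector_mul_lid)
    ultimately show "z \<bullet> (\<Gamma> *v z) > 0"
      \<comment> \<open>Symmetry moves \<open>P\<close> from \<open>z = P *v w\<close> to the other
        factor of the inner product.\<close>
      using inner_matrix_symmetric[OF P(1), of w "w - ?F *v w"]
      by (simp add: z inner_commute)
  qed
  with eq show ?thesis
    by (simp add: closed_loop_trajectory_def gradient_descent_trajectory_iff[OF P(1)])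
qed

end
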